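(* Let $n,s$ be positive integers such that $n\ge 100s$. Let $H$ be a $3$-graph with vertex set $[n]$. If for every $v\in V(H)$, \[ \rho(N_H(v))>\frac{1}{2}\Big(s-1+\sqrt{(s-1)^2+4s(n-s-1)}\Big), \] then $H$ has a matching of size $s+1$.
   Context: $[n]=\{1,\dots,n\}$. A $3$-graph $H$ is a $3$-uniform hypergraph: a vertex set $V(H)$ together with an edge set $E(H)\subseteq\binom{V(H)}{3}$, the family of $3$-element subsets of $V(H)$. For $v\in V(H)$, the link graph $N_H(v)$ is the simple graph with vertex set $V(H)\setminus\{v\}$ and edge set $\{e\subseteq V(H)\setminus\{v\}: e\cup\{v\}\in E(H)\}$ (its edges are $2$-sets). For a simple graph $G$, $\rho(G)$ denotes its spectral radius, i.e. the largest eigenvalue of its adjacency matrix. A matching in $H$ is a collection of pairwise disjoint edges of $H$; its size is the number of edges in it. *)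

theory Defs
  imports "Jordan_Normal_Form.Spectral_Radius"
begin

text \<open>A hypergraph or graph is given by its vertex set and its edge set, the edges being sets
  of vertices.\<close>

definition three_graph :: "'a set \<Rightarrow> 'a set set \<Rightarrow> bool" where
  "three_graph V E \<longleftrightarrow> finite V \<and> (\<forall>e\<in>E. e \<subseteq> V \<and> card e = 3)"

definition link_vertices :: "'a set \<Rightarrow> 'a \<Rightarrow> 'a set" where
  "link_vertices V v = V - {v}"

definition link_edges :: "'a set \<Rightarrow> 'a set set \<Rightarrow> 'a \<Rightarrow> 'a set set" where
  "link_edges V E v = {e. e \<subseteq> V - {v} \<and> e \<union> {v} \<in> E}"

text \<open>Rows and columns are indexed by the vertices in increasing order. If all edges are 2-sets,
  the diagonal is zero, since \<open>{x, x}\<close> is a singleton.\<close>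

definition adjacency_matrix :: "'a::linorder set \<Rightarrow> 'a set set \<Rightarrow> real mat" where
  "adjacency_matrix V E =
     (let vs = sorted_list_of_set V
      in mat (card V) (card V) (\<lambda>(i, j). if {vs ! i, vs ! j} \<in> E then 1 else 0))"

text \<open>The maximum ranges over the real eigenvalues, a nonempty finite set for a simple graph on a
  nonempty finite vertex set, as its adjacency matrix is symmetric.\<close>

definition graph_spectral_radius :: "'a::linorder set \<Rightarrow> 'a set set \<Rightarrow> real" where
  "graph_spectral_radius V E = Max (spectrum (adjacency_matrix V E))"

definition matching :: "'a set set \<Rightarrow> 'a set set \<Rightarrow> bool" where
  "matching E M \<longleftrightarrow> M \<subseteq> E \<and> pairwise disjnt M"

end

theory Submission
  imports Defs
begin

text \<open>
  Let \<open>W\<close> be the set of vertices of degree greater than \<open>3sn\<close>. A matching avoiding \<open>W\<close> extends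
  greedily by one edge through each vertex of \<open>W\<close>, so if there is no matching of size \<open>s + 1\<close>, a
  maximum matching of \<open>H - W\<close> has size \<open>m\<close> with \<open>|W| + m \<le> s\<close>. Let \<open>T\<close> be the set of its
  \<open>3m\<close> vertices and \<open>R\<close> the set of remaining ones. By maximality no edge lies inside \<open>R\<close>, and since
  the vertices of \<open>T\<close> have small degree, averaging gives \<open>u \<in> R\<close> whose link has at most \<open>19ms\<close>
  edges between \<open>T\<close> and \<open>R\<close>. Compared with the extremal link graph, the join of \<open>K\<^sub>s\<close> with an
  independent set, this link lacks \<open>s - |W| \<ge> m\<close> full stars, which outweighs the edges at \<open>T\<close>.
  This is made precise by a positive vector \<open>z\<close> with \<open>A z \<le> l z\<close> for its adjacency matrix \<open>A\<close>,
  where \<open>l\<close> is the extremal spectral radius; such a vector bounds every eigenvalue of \<open>A\<close> by \<open>l\<close>.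
\<close>

section \<open>Eigenvalues of real symmetric matrices and bounds by positive supersolutions\<close>

lemma eigenvalue_coordinates:
  fixes A :: "'a::comm_ring_1 mat"
  assumes A: "A \<in> carrier_mat n n" and ev: "eigenvalue A k"
  obtains v i0 where "i0 < n" "v i0 \<noteq> 0"
    and "\<And>i. i < n \<Longrightarrow> (\<Sum>j<n. A $$ (i, j) * v j) = k * v i"
proof -
  obtain v where v: "v \<in> carrier_vec n" "v \<noteq> 0\<^sub>v n" and eq: "A *\<^sub>v v = k \<cdot>\<^sub>v v"
    using A ev unfolding eigenvalue_def eigenvector_def by auto
  have "(\<Sum>j<n. A $$ (i, j) * v $ j) = k * v $ i" if "i < n" for i
  proof -
    have "(A *\<^sub>v v) $ i = (k \<cdot>\<^sub>v v) $ i"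
      using eq by simp
    then show ?thesis
      using A v(1) that by (simp add: scalar_prod_def atLeast0LessThan)
  qed
  moreover obtain i0 where "i0 < n" "v $ i0 \<noteq> 0"
    using v by (metis carrier_vecD eq_vecI index_zero_vec(1) index_zero_vec(2))
  ultimately show ?thesis
    using that[of i0 "\<lambda>i. v $ i"] by blast
qed

text \<open>This makes the \<open>Max\<close> in \<open>graph_spectral_radius\<close> an actual
  eigenvalue. Over the complex numbers some eigenvalue \<open>k\<close> exists. For an eigenvector
  \<open>v\<close> with squared norm \<open>q\<close>, exchanging the two summations in the
  quadratic form and using symmetry gives \<open>k * q = cnj k * q\<close>. So \<open>k\<close> is
  real, and it is a root of the real characteristic polynomial.\<close>

lemma real_symmetric_spectrum_nonempty:
  fixes A :: "real mat"
  assumes A: "A \<in> carrier_mat n n" and "n > 0"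
    and sym: "\<And>i j. i < n \<Longrightarrow> j < n \<Longrightarrow> A $$ (i, j) = A $$ (j, i)"
  shows "spectrum A \<noteq> {}"
proof -
  let ?B = "map_mat complex_of_real A"
  have B: "?B \<in> carrier_mat n n"
    using A by simp
  from spectrum_non_empty[OF B \<open>n > 0\<close>] obtain k where k: "eigenvalue ?B k"
    unfolding spectrum_def by auto
  from eigenvalue_coordinates[OF B this] obtain v i0 where i0: "i0 < n" "v i0 \<noteq> 0"
    and row': "\<And>i. i < n \<Longrightarrow> (\<Sum>j<n. ?B $$ (i, j) * v j) = k * v i"
    by blast
  have row: "(\<Sum>j<n. of_real (A $$ (i, j)) * v j) = k * v i" if "i < n" for i
    using row'[OF that] that A by simp
  define q where "q = (\<Sum>i<n. v i * cnj (v i))"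
  have q: "q = of_real (\<Sum>i<n. (cmod (v i))\<^sup>2)"
    unfolding q_def by (simp only: complex_norm_square of_real_sum)
  have "(\<Sum>i<n. (cmod (v i))\<^sup>2) > 0"
    by (rule sum_pos2[of _ i0]) (use i0 in auto)
  then have "q \<noteq> 0"
    unfolding q of_real_eq_0_iff by linarith
  have "k * q = (\<Sum>i<n. \<Sum>j<n. of_real (A $$ (i, j)) * v j * cnj (v i))"
    unfolding q_def by (simp add: sum_distrib_left flip: row mult.assoc)
      (simp add: sum_distrib_right)
  also have "\<dots> = (\<Sum>j<n. \<Sum>i<n. of_real (A $$ (i, j)) * v j * cnj (v i))"
    by (rule sum.swap)
  also have "\<dots> = (\<Sum>j<n. v j * cnj (\<Sum>i<n. of_real (A $$ (j, i)) * v i))"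
    by (simp add: sum_distrib_left) (intro sum.cong, auto simp: sym)
  also have "\<dots> = (\<Sum>j<n. v j * cnj (k * v j))"
    by (intro sum.cong refl) (simp only: row lessThan_iff)
  also have "\<dots> = cnj k * q"
    unfolding q_def by (simp add: sum_distrib_left mult_ac)
  finally have "cnj k = k"
    using \<open>q \<noteq> 0\<close> by simp
  then have k': "k = complex_of_real (Re k)"
    by (metis Reals_cnj_iff of_real_Re)
  have "poly (map_poly complex_of_real (char_poly A)) (complex_of_real (Re k)) = 0"
    using k k' eigenvalue_root_char_poly[OF B] of_real_hom.char_poly_hom[OF A] by metis
  then have "poly (char_poly A) (Re k) = 0"
    by simp
  then show ?thesis
    unfolding spectrum_root_char_poly[OF A] by auto
qed

text \<open>Take an eigenvector \<open>v\<close> and a coordinate \<open>i\<close> where the ratio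
  of \<open>\<bar>v i\<bar>\<close> to \<open>z i\<close> attains its maximum \<open>r\<close>.
  There \<open>\<bar>v i\<bar> = r * z i\<close>, while \<open>\<bar>v j\<bar> \<le> r * z j\<close>
  for every \<open>j\<close>, so row \<open>i\<close> of the eigenvalue equation compares
  \<open>k\<close> with \<open>c\<close>.\<close>

lemma eigenvalue_le_of_supersolution:
  fixes A :: "real mat"
  assumes A: "A \<in> carrier_mat n n"
    and nonneg: "\<And>i j. i < n \<Longrightarrow> j < n \<Longrightarrow> A $$ (i, j) \<ge> 0"
    and pos: "\<And>i. i < n \<Longrightarrow> z i > 0"
    and super: "\<And>i. i < n \<Longrightarrow> (\<Sum>j<n. A $$ (i, j) * z j) \<le> c * z i"
    and ev: "eigenvalue A k"
  shows "k \<le> c"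
proof -
  obtain v i0 where i0: "i0 < n" "v i0 \<noteq> 0"
    and row: "\<And>i. i < n \<Longrightarrow> (\<Sum>j<n. A $$ (i, j) * v j) = k * v i"
    using eigenvalue_coordinates[OF A ev] by blast
  define r where "r = Max ((\<lambda>i. \<bar>v i\<bar> / z i) ` {..<n})"
  have "r \<in> (\<lambda>i. \<bar>v i\<bar> / z i) ` {..<n}"
    unfolding r_def using i0 by (intro Max_in) auto
  then obtain i where i: "i < n" "\<bar>v i\<bar> = r * z i"
    using pos by (force simp: field_simps)
  have le: "\<bar>v j\<bar> \<le> r * z j" if "j < n" for j
  proof -
    have "\<bar>v j\<bar> / z j \<le> r"
      unfolding r_def using that by (intro Max_ge) auto
    then show ?thesis
      using pos[OF that] by (simp add: field_simps)
  qed
  have "r > 0"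
    using le[OF i0(1)] i0(2) pos[OF i0(1)] by (smt (verit) mult_nonneg_nonneg zero_less_mult_iff)
  have "k * \<bar>v i\<bar> \<le> \<bar>k * v i\<bar>"
    by (simp add: abs_mult mult_right_mono)
  also have "\<dots> = \<bar>\<Sum>j<n. A $$ (i, j) * v j\<bar>"
    using row[OF i(1)] by simp
  also have "\<dots> \<le> (\<Sum>j<n. A $$ (i, j) * (r * z j))"
    using nonneg i(1) le
    by (intro order.trans[OF sum_abs] sum_mono) (auto simp: abs_mult intro!: mult_left_mono)
  also have "\<dots> = r * (\<Sum>j<n. A $$ (i, j) * z j)"
    by (simp add: sum_distrib_left mult_ac)
  also have "\<dots> \<le> r * (c * z i)"
    using super[OF i(1)] \<open>r > 0\<close> by simp
  also have "\<dots> = c * \<bar>v i\<bar>"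
    using i(2) by simp
  finally show ?thesis
    using i \<open>r > 0\<close> pos[OF i(1)] by simp
qed

lemma graph_spectral_radius_le_of_supersolution:
  fixes V :: "'a::linorder set" and z :: "'a \<Rightarrow> real"
  assumes V: "finite V" "V \<noteq> {}"
    and pos: "\<And>x. x \<in> V \<Longrightarrow> z x > 0"
    and super: "\<And>x. x \<in> V \<Longrightarrow> (\<Sum>y | y \<in> V \<and> {x, y} \<in> E. z y) \<le> c * z x"
  shows "graph_spectral_radius V E \<le> c"
proof -
  define vs where "vs = sorted_list_of_set V"
  define A where "A = adjacency_matrix V E"
  define n where "n = card V"
  have ent: "A $$ (i, j) = (if {vs ! i, vs ! j} \<in> E then 1 else 0)" if "i < n" "j < n" for i j
    using that unfolding A_def adjacency_matrix_def Let_def vs_def n_def by auto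
  have A: "A \<in> carrier_mat n n"
    unfolding A_def adjacency_matrix_def Let_def n_def by auto
  have bij: "bij_betw ((!) vs) {..<n} V"
    unfolding vs_def n_def using V by (intro bij_betw_nth) auto
  have mem: "vs ! i \<in> V" if "i < n" for i
    using bij that by (auto simp: bij_betw_def)
  have "n > 0"
    using V unfolding n_def by (simp add: card_gt_0_iff)
  have le: "k \<le> c" if "eigenvalue A k" for k
  proof (rule eigenvalue_le_of_supersolution[OF A _ _ _ that, of "\<lambda>i. z (vs ! i)"])
    fix i assume i: "i < n"
    have "(\<Sum>j<n. A $$ (i, j) * z (vs ! j))
      = (\<Sum>j<n. (if {vs ! i, vs ! j} \<in> E then 1 else 0) * z (vs ! j))"
      using i by (intro sum.cong) (auto simp: ent)
    also have "\<dots> = (\<Sum>y\<in>V. (if {vs ! i, y} \<in> E then 1 else 0) * z y)"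
      by (rule sum.reindex_bij_betw[OF bij])
    also have "\<dots> = (\<Sum>y | y \<in> V \<and> {vs ! i, y} \<in> E. z y)"
      using V by (intro sum.mono_neutral_cong_right) auto
    also have "\<dots> \<le> c * z (vs ! i)"
      using super mem i by blast
    finally show "(\<Sum>j<n. A $$ (i, j) * z (vs ! j)) \<le> c * z (vs ! i)" .
  qed (auto simp: ent pos mem)
  have "spectrum A \<noteq> {}"
    by (rule real_symmetric_spectrum_nonempty[OF A \<open>n > 0\<close>]) (auto simp: ent insert_commute)
  then have "Max (spectrum A) \<in> spectrum A"
    using card_finite_spectrum[OF A] by (intro Max_in)
  then show ?thesis
    using le unfolding graph_spectral_radius_def A_def[symmetric] spectrum_def by auto
qed

section \<open>Degree counts and greedy extension of matchings in 3-graphs\<close>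

lemma three_graph_finite: "three_graph V E \<Longrightarrow> finite E"
  unfolding three_graph_def by (meson PowI finite_Pow_iff finite_subset subsetI)

lemma card_edges_through_pair_le:
  assumes H: "three_graph V E" and "x \<noteq> v"
  shows "card {e \<in> E. v \<in> e \<and> x \<in> e} \<le> card V"
proof -
  have "{e \<in> E. v \<in> e \<and> x \<in> e} \<subseteq> (\<lambda>y. {v, x, y}) ` V"
  proof
    fix e assume "e \<in> {e \<in> E. v \<in> e \<and> x \<in> e}"
    then have e: "e \<in> E" "v \<in> e" "x \<in> e" by auto
    then have "card (e - {v, x}) = 1" "e \<subseteq> V"
      using H \<open>x \<noteq> v\<close> unfolding three_graph_def
      by (auto simp: card_Diff_subset)
    then obtain y where "e - {v, x} = {y}"
      by (auto simp: card_1_singleton_iff)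
    then show "e \<in> (\<lambda>y. {v, x, y}) ` V"
      using e \<open>e \<subseteq> V\<close> by (intro image_eqI[of _ _ y]) auto
  qed
  then show ?thesis
    using H unfolding three_graph_def by (meson surj_card_le)
qed

lemma card_edges_through_meeting_le:
  assumes H: "three_graph V E" and "finite X" "v \<notin> X"
  shows "card {e \<in> E. v \<in> e \<and> e \<inter> X \<noteq> {}} \<le> card X * card V"
proof -
  have "{e \<in> E. v \<in> e \<and> e \<inter> X \<noteq> {}} = (\<Union>x\<in>X. {e \<in> E. v \<in> e \<and> x \<in> e})"
    by auto
  also have "card \<dots> \<le> (\<Sum>x\<in>X. card {e \<in> E. v \<in> e \<and> x \<in> e})"
    using \<open>finite X\<close> by (rule card_UN_le)
  also have "\<dots> \<le> (\<Sum>x\<in>X. card V)"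
    using card_edges_through_pair_le[OF H] \<open>v \<notin> X\<close> by (intro sum_mono) metis
  finally show ?thesis by simp
qed

text \<open>Induction on \<open>W\<close>. The edges chosen so far and the rest of \<open>W\<close>
  comprise at most \<open>3 * k\<close> vertices, so at most \<open>3 * k * card V\<close> edges
  through \<open>v\<close> meet them, and the degree of \<open>v\<close> leaves one that does not.
  Since this edge also avoids the rest of \<open>W\<close>, the induction hypothesis applies to the
  enlarged matching.\<close>

lemma matching_extend_high_degree:
  assumes H: "three_graph V E"
  shows "finite W \<Longrightarrow> matching E M \<Longrightarrow> W \<inter> \<Union>M = {} \<Longrightarrow> card M + card W = k + 1 \<Longrightarrow>
    \<forall>v\<in>W. card {e \<in> E. v \<in> e} > 3 * k * card V \<Longrightarrow>
    \<exists>M'. matching E M' \<and> card M' = k + 1"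
proof (induction W arbitrary: M rule: finite_induct)
  case empty
  then show ?case by auto
next
  case (insert v W)
  define X where "X = \<Union>M \<union> W"
  have finM: "finite M" "M \<subseteq> E"
    using insert.prems(1) three_graph_finite[OF H] unfolding matching_def
    by (auto intro: finite_subset)
  have c3: "card e = 3 \<and> finite e" if "e \<in> M" for e
    using that finM H unfolding three_graph_def by (metis card.infinite subsetD zero_neq_numeral)
  have X: "finite X" "v \<notin> X"
    using c3 finM insert unfolding X_def by auto
  have "card (\<Union>M) \<le> (\<Sum>e\<in>M. card e)"
    by (rule card_Union_le_sum_card)
  also have "\<dots> = 3 * card M"
    using c3 by simp
  finally have "card X \<le> 3 * card M + card W"
    unfolding X_def using card_Un_le[of "\<Union>M" W] by linarith
  also have "\<dots> \<le> 3 * k"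
    using insert by simp
  finally have "card {e \<in> E. v \<in> e \<and> e \<inter> X \<noteq> {}} \<le> 3 * k * card V"
    using card_edges_through_meeting_le[OF H X] by (meson le_trans mult_le_mono1)
  moreover have "card {e \<in> E. v \<in> e} > 3 * k * card V"
    using insert.prems by auto
  ultimately have "\<not> {e \<in> E. v \<in> e} \<subseteq> {e \<in> E. v \<in> e \<and> e \<inter> X \<noteq> {}}"
    using card_mono[of "{e \<in> E. v \<in> e \<and> e \<inter> X \<noteq> {}}" "{e \<in> E. v \<in> e}"]
      three_graph_finite[OF H] by auto
  then obtain e where e: "e \<in> E" "v \<in> e" "e \<inter> X = {}"
    by auto
  have "e \<notin> M"
    using e insert.prems by auto
  show ?case
  proof (rule insert.IH[of "insert e M"])
    show "matching E (insert e M)"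
      using insert.prems(1) e unfolding matching_def X_def
      by (auto simp: pairwise_insert disjnt_def)
    show "W \<inter> \<Union>(insert e M) = {}"
      using insert.prems e unfolding X_def by auto
    show "card (insert e M) + card W = k + 1"
      using insert \<open>e \<notin> M\<close> finM by simp
    show "\<forall>v\<in>W. card {e \<in> E. v \<in> e} > 3 * k * card V"
      using insert.prems by auto
  qed
qed

text \<open>An edge through \<open>v\<close> fixes the pair \<open>(u, y)\<close> up to order.
  Coincidences among \<open>u\<close>, \<open>v\<close>, \<open>y\<close> cannot occur, because
  edges have three elements.\<close>

lemma card_ordered_pairs_completing_le:
  assumes H: "three_graph V E"
  shows "card {(u, y). {u, v, y} \<in> E} \<le> 2 * card {e \<in> E. v \<in> e}"
proof -
  have fin: "finite {e \<in> E. v \<in> e}"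
    using three_graph_finite[OF H] by simp
  have pairs: "card P \<le> 2" if P: "e \<in> E" "v \<in> e" "P = {(u, y). {u, v, y} = e}" for e P
  proof -
    have "card (e - {v}) = 2"
      using H P unfolding three_graph_def by (auto simp: card_Diff_subset)
    then obtain a b where ab: "e - {v} = {a, b}" "a \<noteq> b"
      by (auto simp: card_2_iff)
    have "P \<subseteq> {(a, b), (b, a)}"
    proof
      fix p assume "p \<in> P"
      then obtain u y where p: "p = (u, y)" "{u, v, y} = e"
        using P by auto
      have "card {u, v, y} = 3"
        using p H P unfolding three_graph_def by auto
      then have "u \<noteq> v" "y \<noteq> v"
        by (auto simp: card_insert_if split: if_splits)
      then have "e - {v} = {u, y}"
        unfolding p(2)[symmetric] by auto
      then show "p \<in> {(a, b), (b, a)}"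
        unfolding p(1) ab(1) doubleton_eq_iff by blast
    qed
    then have "card P \<le> card {(a, b), (b, a)}"
      by (intro card_mono) auto
    also have "\<dots> = 2"
      using ab(2) by simp
    finally show ?thesis .
  qed
  have "{(u, y). {u, v, y} \<in> E} = (\<Union>e\<in>{e \<in> E. v \<in> e}. {(u, y). {u, v, y} = e})"
    by auto
  also have "card \<dots> \<le> (\<Sum>e\<in>{e \<in> E. v \<in> e}. card {(u, y). {u, v, y} = e})"
    using fin by (rule card_UN_le)
  also have "\<dots> \<le> (\<Sum>e\<in>{e \<in> E. v \<in> e}. 2)"
    using pairs by (intro sum_mono) auto
  finally show ?thesis by simp
qed

section \<open>Spectral radius of a graph close to the extremal link\<close>

text \<open>These are the inequalities needed in \<open>spectral_radius_threshold\<close>: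
  \<open>Z\<close> is the total weight on \<open>T\<close>, the first bound serves the vertices of
  \<open>T\<close> and the second those of \<open>W\<close>. The second is an equality in the
  extremal case \<open>w = s\<close>, \<open>m = 0\<close>, \<open>r = N - s\<close>. In general its
  error terms are at most \<open>46 / 3 * (s * m)\<close> and \<open>64 * (s * m)\<close>, and the
  loss from \<open>w\<close> to \<open>s\<close> provides at least
  \<open>80 * (s * m)\<close>.\<close>

lemma supersolution_numerics:
  fixes s w m r N D l :: real
  assumes "s \<ge> 1" "N \<ge> 99 * s" "w \<ge> 0" "m \<ge> 0" "w + m \<le> s" "r \<ge> 0" "r \<le> N - w"
    and "D \<ge> 0" "D \<le> 19 * m * s"
    and "l > 0" and l2: "l\<^sup>2 = (s - 1) * l + s * (N - s)"
  defines "Z \<equiv> 3 * s * (3 * m + D / l) / l"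
  shows "s + Z \<le> 3 * s"
    and "(w - 1 + Z) * l + w * r + 3 * s / l * (D + D * N / l) \<le> l\<^sup>2"
proof -
  have "l\<^sup>2 \<ge> s * (N - s)"
    using l2 assms by simp
  have "s * (N - s) \<ge> s * (98 * s)"
    using assms by (intro mult_left_mono) auto
  then have l98: "l\<^sup>2 \<ge> 98 * s\<^sup>2"
    using \<open>l\<^sup>2 \<ge> s * (N - s)\<close> by (simp add: power2_eq_square)
  have "l \<ge> 9 * s"
  proof (rule power2_le_imp_le)
    have "(9 * s)\<^sup>2 = 81 * s\<^sup>2"
      by (simp add: power_mult_distrib)
    then show "(9 * s)\<^sup>2 \<le> l\<^sup>2"
      using l98 zero_le_power2[of s] by linarith
  qed (use assms in auto)
  have sl: "s / l \<le> 1 / 9"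
    using \<open>l \<ge> 9 * s\<close> \<open>l > 0\<close> by (simp add: field_simps)
  have "98 * (s * N) \<le> 99 * (s * (N - s))"
    using mult_left_mono[of "99 * s" N s] assms by (simp add: algebra_simps)
  then have sN: "s * N / l\<^sup>2 \<le> 99 / 98"
    using \<open>l\<^sup>2 \<ge> s * (N - s)\<close> \<open>l > 0\<close> by (simp add: field_simps)
  have ml: "m / l \<le> 1 / 9"
    using sl assms divide_right_mono[of m s l] by linarith
  have "D / l\<^sup>2 \<le> 19 * m * s / l\<^sup>2"
    using assms by (intro divide_right_mono) auto
  also have "\<dots> \<le> 19 * s\<^sup>2 / l\<^sup>2"
    using assms by (intro divide_right_mono) (auto simp: power2_eq_square intro!: mult_right_mono)
  also have "\<dots> \<le> 19 / 98"
    using l98 \<open>l > 0\<close> by (simp add: field_simps)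
  finally have "3 * (m / l) + D / l\<^sup>2 \<le> 2 / 3"
    using ml by linarith
  moreover have Z: "Z = 3 * s * (3 * (m / l) + D / l\<^sup>2)"
    unfolding Z_def using \<open>l > 0\<close> by (simp add: field_simps power2_eq_square)
  ultimately show "s + Z \<le> 3 * s"
    using mult_left_mono[of "3 * (m / l) + D / l\<^sup>2" "2 / 3" "3 * s"] assms by simp
  have Dl: "D / l \<le> 19 / 9 * m"
  proof -
    have "D / l \<le> 19 * m * s / l"
      using assms by (intro divide_right_mono) auto
    also have "\<dots> = 19 * m * (s / l)"
      by simp
    also have "\<dots> \<le> 19 * m * (1 / 9)"
      using sl assms by (intro mult_left_mono) auto
    finally show ?thesis by simp
  qed
  have "Z * l = 3 * s * (3 * m + D / l)"
    unfolding Z_def using \<open>l > 0\<close> by simp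
  also have "\<dots> \<le> 3 * s * (3 * m + 19 / 9 * m)"
    using Dl assms by (intro mult_left_mono) auto
  finally have Zl: "Z * l \<le> 46 / 3 * (s * m)"
    by (simp add: mult.commute)
  have "3 * s / l * (D + D * N / l) = 3 * D * (s / l + s * N / l\<^sup>2)"
    using \<open>l > 0\<close> by (simp add: field_simps power2_eq_square)
  also have "\<dots> \<le> 3 * D * (1 / 9 + 99 / 98)"
    using add_mono[OF sl sN] \<open>D \<ge> 0\<close> by (intro mult_left_mono) auto
  also have "\<dots> \<le> 3 * (19 * m * s) * (1 / 9 + 99 / 98)"
    using assms by (intro mult_right_mono) auto
  also have "\<dots> \<le> 64 * (s * m)"
    using mult_nonneg_nonneg[of m s] assms(1,4) by (simp add: algebra_simps)
  finally have S: "3 * s / l * (D + D * N / l) \<le> 64 * (s * m)" .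
  \<comment> \<open>The gain from the missing stars: \<open>m \<le> s - w\<close>, and
    \<open>N - (s + w) \<ge> 97 * s\<close> leaves room for the factor 80.\<close>
  have "80 * (s * m) \<le> 80 * (s * (s - w))"
    using assms by (intro mult_left_mono) auto
  also have "\<dots> \<le> (s - w) * (N - (s + w))"
    using mult_left_mono[of "80 * s" "N - (s + w)" "s - w"] assms by (simp add: algebra_simps)
  also have "\<dots> = s * (N - s) - w * (N - w)"
    by (simp add: algebra_simps)
  also have "\<dots> \<le> s * (N - s) - w * r"
    using mult_left_mono[of r "N - w" w] assms by simp
  finally have "80 * (s * m) + w * r \<le> s * (N - s)"
    by simp
  moreover have "(w - 1) * l \<le> (s - 1) * l"
    using assms by (intro mult_right_mono) auto
  moreover have "s * m \<ge> 0"
    using assms by simp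
  ultimately show "(w - 1 + Z) * l + w * r + 3 * s / l * (D + D * N / l) \<le> l\<^sup>2"
    using Zl S by (simp add: l2 distrib_right)
qed

text \<open>The equation for \<open>l\<close> is the characteristic equation of the quotient matrix
  with rows \<open>(s - 1, N - s)\<close> and \<open>(s, 0)\<close>, where
  \<open>N = card V\<close>. This matrix belongs to the join of \<open>K\<^sub>s\<close> with an
  independent set of \<open>N - s\<close> vertices, so \<open>l\<close> is the spectral radius of
  that join.\<close>

lemma spectral_radius_threshold:
  fixes V :: "'a::linorder set" and s m :: nat and l :: real
  assumes fin: "finite V" and V: "V = W \<union> T \<union> R" "W \<inter> T = {}" "W \<inter> R = {}" "T \<inter> R = {}"
    and noloop: "\<And>x. {x} \<notin> G"
    and indep: "\<And>x y. x \<in> R \<Longrightarrow> y \<in> R \<Longrightarrow> {x, y} \<notin> G"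
    and "card T = 3 * m" "card W + m \<le> s" "s > 0" "card V \<ge> 99 * s"
    and D: "card {(v, y). v \<in> T \<and> y \<in> R \<and> {v, y} \<in> G} \<le> 19 * m * s"
    and l: "l > 0" "l\<^sup>2 = (real s - 1) * l + real s * (real (card V) - real s)"
  shows "graph_spectral_radius V G \<le> l"
proof -
  define N where "N = real (card V)"
  define w where "w = real (card W)"
  define d where "d v = card {y \<in> R. {v, y} \<in> G}" for v
  define D where "D = real (card {(v, y). v \<in> T \<and> y \<in> R \<and> {v, y} \<in> G})"
  \<comment> \<open>\<open>W\<close> carries constant weight 1; on \<open>R\<close> the inequality is made an equality (up to
    replacing \<open>card W\<close> by \<open>om\<close>, which keeps \<open>z\<close> positive when \<open>W\<close> is empty), and on \<open>T\<close> all
    incoming weights are bounded crudely by \<open>K\<close>.\<close>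
  define K where "K = 3 * real s"
  define zeta where "zeta v = K * (1 + d v / l) / l" for v
  define Z where "Z = (\<Sum>v\<in>T. zeta v)"
  define om where "om = max w 1"
  define S where "S y = (\<Sum>v | v \<in> T \<and> {y, v} \<in> G. zeta v)" for y
  define z where "z x = (if x \<in> W then 1 else if x \<in> T then zeta x else (om + S x) / l)" for x
  have finWTR: "finite W" "finite T" "finite R"
    using fin V by auto
  have cardV: "N = w + 3 * real m + real (card R)"
  proof -
    have "card V = card W + card T + card R"
      using V finWTR by (simp add: card_Un_disjoint Int_Un_distrib2)
    then show ?thesis
      using \<open>card T = 3 * m\<close> unfolding N_def w_def by simp
  qed
  have Dd: "D = (\<Sum>v\<in>T. real (d v))"
  proof -
    have "{(v, y). v \<in> T \<and> y \<in> R \<and> {v, y} \<in> G} = Sigma T (\<lambda>v. {y \<in> R. {v, y} \<in> G})"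
      by auto
    then show ?thesis
      unfolding D_def d_def using finWTR by simp
  qed
  have dN: "real (d v) \<le> N" for v
  proof -
    have "d v \<le> card R"
      unfolding d_def using finWTR by (intro card_mono) auto
    then show ?thesis
      unfolding cardV w_def by simp
  qed
  have K: "K > 0"
    unfolding K_def using \<open>s > 0\<close> by simp
  have zeta_pos: "zeta v > 0" for v
    unfolding zeta_def using K l by (intro divide_pos_pos mult_pos_pos add_pos_nonneg) auto
  have Z: "Z = 3 * real s * (3 * real m + D / l) / l"
  proof -
    have "Z = K / l * (\<Sum>v\<in>T. 1 + d v / l)"
      unfolding Z_def zeta_def sum_distrib_left by (intro sum.cong) auto
    also have "(\<Sum>v\<in>T. 1 + d v / l) = 3 * real m + D / l"
      unfolding Dd using \<open>card T = 3 * m\<close> by (simp add: sum.distrib sum_divide_distrib)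
    finally show ?thesis
      unfolding K_def by simp
  qed
  have num: "real s + Z \<le> K"
    "(w - 1 + Z) * l + w * real (card R) + K / l * (D + D * N / l) \<le> l\<^sup>2"
  proof -
    have "real s \<ge> 1" "N \<ge> 99 * real s" "w + real m \<le> real s"
      using \<open>s > 0\<close> \<open>card V \<ge> 99 * s\<close> \<open>card W + m \<le> s\<close> unfolding N_def w_def by linarith+
    moreover have "w \<ge> 0" "real m \<ge> 0" "real (card R) \<ge> 0" "real (card R) \<le> N - w" "D \<ge> 0"
      unfolding cardV w_def D_def by simp_all
    moreover have "D \<le> 19 * real m * real s"
      using of_nat_mono[OF D, where 'a = real] unfolding D_def by simp
    moreover have "l\<^sup>2 = (real s - 1) * l + real s * (N - real s)"
      using l unfolding N_def by simp
    ultimately have *: "real s \<ge> 1" "N \<ge> 99 * real s" "w \<ge> 0" "real m \<ge> 0"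
      "w + real m \<le> real s" "real (card R) \<ge> 0" "real (card R) \<le> N - w" "D \<ge> 0"
      "D \<le> 19 * real m * real s" "l\<^sup>2 = (real s - 1) * l + real s * (N - real s)"
      by (simp_all only:)
    show "real s + Z \<le> K"
      "(w - 1 + Z) * l + w * real (card R) + K / l * (D + D * N / l) \<le> l\<^sup>2"
      using supersolution_numerics[OF *(1-9) l(1) *(10)] unfolding Z K_def by simp_all
  qed
  have "om \<le> real s"
    using \<open>s > 0\<close> \<open>card W + m \<le> s\<close> unfolding om_def w_def by simp
  have S: "0 \<le> S y" "S y \<le> Z" for y
    unfolding S_def Z_def using finWTR zeta_pos
    by (auto intro!: sum_nonneg sum_mono2 simp: less_imp_le)
  \<comment> \<open>Double counting of the edges between \<open>T\<close> and \<open>R\<close>, each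
    weighted by \<open>zeta\<close> at its end in \<open>T\<close>.\<close>
  have sumS: "(\<Sum>y\<in>R. S y) = (\<Sum>v\<in>T. zeta v * d v)"
  proof -
    have "(\<Sum>y\<in>R. S y) = (\<Sum>y\<in>R. \<Sum>v\<in>T. if {v, y} \<in> G then zeta v else 0)"
      unfolding S_def using finWTR
      by (intro sum.cong sum.mono_neutral_cong_left) (auto simp: insert_commute)
    also have "\<dots> = (\<Sum>v\<in>T. \<Sum>y\<in>R. if {v, y} \<in> G then zeta v else 0)"
      by (rule sum.swap)
    also have "\<dots> = (\<Sum>v\<in>T. \<Sum>y\<in>{y \<in> R. {v, y} \<in> G}. zeta v)"
      using finWTR by (intro sum.cong sum.mono_neutral_cong_right) auto
    finally show ?thesis
      unfolding d_def by (simp add: mult.commute)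
  qed
  have z: "x \<in> W \<Longrightarrow> z x = 1" "x \<in> T \<Longrightarrow> z x = zeta x" "x \<in> R \<Longrightarrow> z x = (om + S x) / l" for x
    using V(2-4) unfolding z_def by (auto simp: disjoint_iff)
  have nbr_sum: "(\<Sum>y | y \<in> V \<and> {x, y} \<in> G. z y)
    = real (card {y \<in> W. {x, y} \<in> G}) + S x + (\<Sum>y | y \<in> R \<and> {x, y} \<in> G. (om + S y) / l)" for x
  proof -
    have "{y. y \<in> V \<and> {x, y} \<in> G} = {y \<in> W. {x, y} \<in> G} \<union> {v. v \<in> T \<and> {x, v} \<in> G}
        \<union> {y. y \<in> R \<and> {x, y} \<in> G}"
      using V by auto
    also have "sum z \<dots> = sum z {y \<in> W. {x, y} \<in> G} + sum z {v. v \<in> T \<and> {x, v} \<in> G}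
        + sum z {y. y \<in> R \<and> {x, y} \<in> G}"
      using V finWTR by (subst sum.union_disjoint; (subst sum.union_disjoint)?) auto
    also have "sum z {y \<in> W. {x, y} \<in> G} = real (card {y \<in> W. {x, y} \<in> G})"
      by (simp add: z(1))
    also have "sum z {v. v \<in> T \<and> {x, v} \<in> G} = S x"
      unfolding S_def by (intro sum.cong refl) (simp add: z(2))
    also have "sum z {y. y \<in> R \<and> {x, y} \<in> G} = (\<Sum>y | y \<in> R \<and> {x, y} \<in> G. (om + S y) / l)"
      by (intro sum.cong refl) (simp add: z(3))
    finally show ?thesis .
  qed
  have Wle: "real (card {y \<in> W. {x, y} \<in> G}) \<le> w" for x
    unfolding w_def using finWTR by (auto intro!: card_mono)
  show ?thesis
  proof (rule graph_spectral_radius_le_of_supersolution[of V z])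
    show "finite V" by fact
    show "V \<noteq> {}"
      using \<open>card V \<ge> 99 * s\<close> \<open>s > 0\<close> by auto
    show "z x > 0" for x
      using zeta_pos l S(1)[of x] unfolding z_def om_def by (auto intro!: add_pos_nonneg)
    fix x assume "x \<in> V"
    then consider "x \<in> W" | "x \<in> T" | "x \<in> R"
      using V by auto
    then show "(\<Sum>y | y \<in> V \<and> {x, y} \<in> G. z y) \<le> l * z x"
    proof cases
      assume x: "x \<in> W"
      then have "card W > 0"
        using finWTR by (auto simp: card_gt_0_iff)
      then have om: "om = w"
        unfolding om_def w_def by simp
      \<comment> \<open>Excluding \<open>x\<close> itself matters: the bound \<open>w - 1\<close>
        matches the coefficient \<open>s - 1\<close> in the equation for \<open>l\<close>, and the
        estimate has no slack when \<open>w = s\<close>.\<close>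
      have "{y \<in> W. {x, y} \<in> G} \<subseteq> W - {x}"
        using noloop[of x] by auto
      then have "card {y \<in> W. {x, y} \<in> G} \<le> card (W - {x})"
        using finWTR by (intro card_mono) auto
      then have a: "real (card {y \<in> W. {x, y} \<in> G}) \<le> w - 1"
        using x finWTR \<open>card W > 0\<close> unfolding w_def by simp
      have "(\<Sum>v\<in>T. zeta v * d v) = K / l * (\<Sum>v\<in>T. d v + d v * d v / l)"
        unfolding zeta_def sum_distrib_left by (intro sum.cong) (auto simp: field_simps)
      also have "\<dots> \<le> K / l * (\<Sum>v\<in>T. d v + d v * N / l)"
        using K l dN
        by (intro mult_left_mono sum_mono add_left_mono divide_right_mono) (auto intro: mult_left_mono)
      also have "\<dots> = K / l * (D + D * N / l)"
        unfolding Dd by (simp add: sum.distrib sum_divide_distrib sum_distrib_right)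
      finally have b: "(\<Sum>v\<in>T. zeta v * d v) \<le> K / l * (D + D * N / l)" .
      have "(\<Sum>y | y \<in> R \<and> {x, y} \<in> G. (om + S y) / l) \<le> (\<Sum>y\<in>R. (om + S y) / l)"
        using finWTR S l unfolding om_def
        by (intro sum_mono2) (auto intro!: divide_nonneg_nonneg add_nonneg_nonneg)
      also have "\<dots> = (w * real (card R) + (\<Sum>v\<in>T. zeta v * d v)) / l"
        using sumS unfolding om by (simp add: sum.distrib flip: sum_divide_distrib)
      also have "\<dots> \<le> (l\<^sup>2 - (w - 1 + Z) * l) / l"
        using num(2) b l by (intro divide_right_mono) auto
      also have "\<dots> = l - (w - 1 + Z)"
        using l by (simp add: field_simps power2_eq_square)
      finally show ?thesis
        unfolding nbr_sum using a S(2)[of x] x by (simp add: z(1))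
    next
      assume x: "x \<in> T"
      \<comment> \<open>\<open>K\<close> bounds \<open>s + Z\<close>, hence both the numerator
        \<open>om + S y\<close> here and the total weight coming from \<open>W\<close> and
        \<open>T\<close> below.\<close>
      have "(\<Sum>y | y \<in> R \<and> {x, y} \<in> G. (om + S y) / l) \<le> (\<Sum>y | y \<in> R \<and> {x, y} \<in> G. K / l)"
        using S(2) \<open>om \<le> real s\<close> num(1) l
        by (intro sum_mono divide_right_mono) (smt (verit), simp)
      also have "\<dots> = d x * (K / l)"
        unfolding d_def by simp
      finally have "(\<Sum>y | y \<in> V \<and> {x, y} \<in> G. z y) \<le> K + d x * (K / l)"
        unfolding nbr_sum using Wle[of x] S(2)[of x] \<open>om \<le> real s\<close> num(1) unfolding om_def by linarith
      also have "\<dots> = l * z x"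
        using x l by (simp add: z(2) zeta_def field_simps)
      finally show ?thesis .
    next
      assume x: "x \<in> R"
      then have "(\<Sum>y | y \<in> R \<and> {x, y} \<in> G. (om + S y) / l) = 0"
        using indep by (intro sum.neutral) auto
      moreover have "l * z x = om + S x"
        using x l by (simp add: z(3))
      ultimately show ?thesis
        unfolding nbr_sum using Wle[of x] unfolding om_def by simp
    qed
  qed
qed

section \<open>Choosing a vertex whose link violates the spectral hypothesis\<close>

theorem theorem1p3:
  fixes n s :: nat and E :: "nat set set"
  assumes "n > 0" and "s > 0" and "n \<ge> 100 * s"
    and "three_graph {1..n} E"
    and "\<forall>v\<in>{1..n}.
      graph_spectral_radius (link_vertices {1..n} v) (link_edges {1..n} E v) >
        1 / 2 * (real s - 1 + sqrt ((real s - 1)\<^sup>2 + 4 * real s * (real n - real s - 1)))"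
  shows "\<exists>M. matching E M \<and> card M = s + 1"
proof (rule ccontr)
  assume none: "\<not> (\<exists>M. matching E M \<and> card M = s + 1)"
  define V where "V = {1..n}"
  have H: "three_graph V E" and V: "finite V" "card V = n"
    using assms unfolding V_def by auto
  \<comment> \<open>The threshold is the degree condition of
    \<open>matching_extend_high_degree\<close> for \<open>k = s\<close>.\<close>
  define W where "W = {v \<in> V. card {e \<in> E. v \<in> e} > 3 * s * card V}"
  have "finite W"
    using V unfolding W_def by auto
  have few: "card M + card W \<le> s" if M: "matching E M" "\<Union>M \<inter> W = {}" for M
  proof (rule ccontr)
    assume "\<not> card M + card W \<le> s"
    \<comment> \<open>\<open>W\<close> may have more than \<open>s + 1\<close> vertices. Truncating
      \<open>W\<close> and then \<open>M\<close> makes the sizes add up to exactly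
      \<open>s + 1\<close>.\<close>
    define a where "a = min (card W) (s + 1)"
    obtain W' where W': "W' \<subseteq> W" "card W' = a"
      using obtain_subset_with_card_n[of a W] unfolding a_def by auto
    have "s + 1 - a \<le> card M"
      using \<open>\<not> card M + card W \<le> s\<close> unfolding a_def by auto
    then obtain M' where M': "M' \<subseteq> M" "card M' = s + 1 - a"
      using obtain_subset_with_card_n by metis
    have "\<exists>M''. matching E M'' \<and> card M'' = s + 1"
    proof (rule matching_extend_high_degree[OF H, of W' M'])
      show "finite W'"
        using W' \<open>finite W\<close> finite_subset by blast
      show "matching E M'"
        using M M' pairwise_subset unfolding matching_def by blast
      show "W' \<inter> \<Union>M' = {}"
        using M M' W' by blast
      show "card M' + card W' = s + 1"
        using M' W' unfolding a_def by simp
      show "\<forall>v\<in>W'. card {e \<in> E. v \<in> e} > 3 * s * card V"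
        using W' unfolding W_def by auto
    qed
    then show False
      using none by simp
  qed
  have "\<exists>M. (matching E M \<and> \<Union>M \<inter> W = {}) \<and>
      (\<forall>M'. matching E M' \<and> \<Union>M' \<inter> W = {} \<longrightarrow> card M' \<le> card M)"
    by (rule ex_has_greatest_nat[of _ "{}" _ "s + 1"])
      (use few in \<open>auto simp: matching_def less_Suc_eq_le intro: add_leD1\<close>)
  then obtain M where M: "matching E M" "\<Union>M \<inter> W = {}"
    and max: "\<And>M'. matching E M' \<Longrightarrow> \<Union>M' \<inter> W = {} \<Longrightarrow> card M' \<le> card M"
    by blast
  define m where "m = card M"
  define T where "T = \<Union>M"
  define R where "R = V - W - T"
  have "card W + m \<le> s"
    using few[OF M] unfolding m_def by simp
  have "M \<subseteq> E" and disj: "pairwise disjnt M"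
    using M unfolding matching_def by auto
  then have c3: "e \<subseteq> V \<and> card e = 3 \<and> finite e" if "e \<in> M" for e
    using that H finite_subset[OF _ V(1)] unfolding three_graph_def by blast
  have "finite M"
    using \<open>M \<subseteq> E\<close> three_graph_finite[OF H] finite_subset by blast
  have "T \<subseteq> V"
    using c3 unfolding T_def by blast
  have cardT: "card T = 3 * m"
    using card_Union_disjoint[OF disj] c3 unfolding T_def m_def by simp
  have fin: "finite T" "finite R"
    using \<open>T \<subseteq> V\<close> V finite_subset unfolding R_def by auto
  \<comment> \<open>\<open>W\<close> and \<open>T\<close> together have at most
    \<open>card W + 3 * m \<le> 3 * s\<close> vertices.\<close>
  have cardR: "card R + 3 * s \<ge> n"
  proof -
    have "V \<subseteq> W \<union> T \<union> R"
      unfolding R_def by auto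
    then have "card V \<le> card (W \<union> T \<union> R)"
      using fin \<open>finite W\<close> by (intro card_mono) auto
    also have "\<dots> \<le> card W + card T + card R"
      using card_Un_le[of "W \<union> T" R] card_Un_le[of W T] by linarith
    finally show ?thesis
      using V cardT \<open>card W + m \<le> s\<close> by linarith
  qed
  have indep: "{u, x, y} \<notin> E" if "u \<in> R" "x \<in> R" "y \<in> R" for u x y
  proof
    assume e: "{u, x, y} \<in> E"
    have "{u, x, y} \<inter> T = {}" "{u, x, y} \<inter> W = {}"
      using that unfolding R_def by auto
    then have "matching E (insert {u, x, y} M)" "\<Union>(insert {u, x, y} M) \<inter> W = {}"
      and "{u, x, y} \<notin> M"
      using M e unfolding matching_def T_def by (auto simp: pairwise_insert disjnt_def)
    then show False
      using max[of "insert {u, x, y} M"] \<open>finite M\<close> by simp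
  qed
  \<comment> \<open>\<open>c u\<close> counts the edges between \<open>T\<close> and
    \<open>R\<close> in the link of \<open>u\<close>. As \<open>T\<close> and \<open>R\<close> are
    disjoint, each edge gives one ordered pair.\<close>
  define c where "c u = card {(v, y). v \<in> T \<and> y \<in> R \<and> {u, v, y} \<in> E}" for u
  have deg: "card {(u, y). u \<in> R \<and> y \<in> R \<and> {u, v, y} \<in> E} \<le> 6 * s * n" if "v \<in> T" for v
  proof -
    have "{(u, y). {u, v, y} \<in> E} \<subseteq> V \<times> V"
      using H unfolding three_graph_def by (auto dest!: bspec)
    then have "finite {(u, y). {u, v, y} \<in> E}"
      using V finite_subset by blast
    then have "card {(u, y). u \<in> R \<and> y \<in> R \<and> {u, v, y} \<in> E} \<le> card {(u, y). {u, v, y} \<in> E}"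
      by (rule card_mono) auto
    also have "\<dots> \<le> 2 * card {e \<in> E. v \<in> e}"
      by (rule card_ordered_pairs_completing_le[OF H])
    also have "card {e \<in> E. v \<in> e} \<le> 3 * s * n"
      using that M(2) \<open>T \<subseteq> V\<close> V(2) unfolding W_def T_def by force
    finally show ?thesis by simp
  qed
  \<comment> \<open>The triples \<open>(u, v, y)\<close> are counted first by \<open>u\<close> in
    \<open>R\<close>, then by \<open>v\<close> in \<open>T\<close>. The \<open>3 * m\<close>
    vertices of \<open>T\<close> lie outside \<open>W\<close>, so each contributes at most
    \<open>6 * s * n\<close>.\<close>
  have "(\<Sum>u\<in>R. c u) = card (Sigma R (\<lambda>u. {(v, y). v \<in> T \<and> y \<in> R \<and> {u, v, y} \<in> E}))"
  proof -
    have "finite {(v, y). v \<in> T \<and> y \<in> R \<and> {u, v, y} \<in> E}" for u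
      by (rule finite_subset[of _ "T \<times> R"]) (use fin in auto)
    then show ?thesis
      unfolding c_def using fin by (subst card_SigmaI) auto
  qed
  also have "\<dots> = card (Sigma T (\<lambda>v. {(u, y). u \<in> R \<and> y \<in> R \<and> {u, v, y} \<in> E}))"
    by (rule bij_betw_same_card[of "\<lambda>(u, v, y). (v, u, y)"],
        rule bij_betw_byWitness[of _ "\<lambda>(v, u, y). (u, v, y)"]) auto
  also have "\<dots> = (\<Sum>v\<in>T. card {(u, y). u \<in> R \<and> y \<in> R \<and> {u, v, y} \<in> E})"
  proof -
    have "finite {(u, y). u \<in> R \<and> y \<in> R \<and> {u, v, y} \<in> E}" for v
      by (rule finite_subset[of _ "R \<times> R"]) (use fin in auto)
    then show ?thesis
      using fin by (subst card_SigmaI) auto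
  qed
  also have "\<dots> \<le> (\<Sum>v\<in>T. 6 * s * n)"
    using deg by (intro sum_mono)
  also have "\<dots> = m * s * (18 * n)"
    using cardT by simp
  finally have total: "(\<Sum>u\<in>R. c u) \<le> m * s * (18 * n)" .
  \<comment> \<open>Averaging over \<open>R\<close>: from \<open>card R \<ge> n - 3 * s\<close> and
    \<open>n \<ge> 100 * s\<close> follows \<open>18 * n \<le> 19 * card R\<close>. The
    \<open>+ 1\<close> in the negated bound yields a strict contradiction even for
    \<open>m = 0\<close>.\<close>
  obtain u where u: "u \<in> R" "c u \<le> 19 * m * s"
  proof (rule ccontr)
    assume "\<not> thesis"
    then have "c u \<ge> 19 * m * s + 1" if "u \<in> R" for u
      using that \<open>\<And>u. u \<in> R \<Longrightarrow> c u \<le> 19 * m * s \<Longrightarrow> thesis\<close> by (metis Suc_eq_plus1 not_less_eq_eq)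
    then have "card R * (19 * m * s + 1) \<le> (\<Sum>u\<in>R. c u)"
      using sum_bounded_below[of R "19 * m * s + 1" c] by simp
    moreover have "m * s * (18 * n) \<le> m * s * (19 * card R)"
      using cardR assms(3) by (intro mult_le_mono2) linarith
    moreover have "card R > 0"
      using cardR assms(2,3) by linarith
    ultimately show False
      using total by (simp add: algebra_simps)
  qed
  have "u \<in> V"
    using u unfolding R_def by simp
  define G where "G = link_edges V E u"
  define l where "l = 1 / 2 * (real s - 1 + sqrt ((real s - 1)\<^sup>2 + 4 * real s * (real n - real s - 1)))"
  have "graph_spectral_radius (link_vertices V u) G \<le> l"
  proof (rule spectral_radius_threshold[of _ W T "R - {u}" _ m s])
    show "finite (link_vertices V u)" "link_vertices V u = W \<union> T \<union> (R - {u})"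
      using u V \<open>T \<subseteq> V\<close> unfolding link_vertices_def R_def W_def by auto
    show "W \<inter> T = {}" "W \<inter> (R - {u}) = {}" "T \<inter> (R - {u}) = {}"
      using M unfolding T_def R_def by auto
    show "{x} \<notin> G" for x
    proof
      assume "{x} \<in> G"
      then have "card {x, u} = 3"
        using H unfolding G_def link_edges_def three_graph_def by auto
      then show False
        by (simp add: card_insert_if split: if_splits)
    qed
    show "{x, y} \<notin> G" if "x \<in> R - {u}" "y \<in> R - {u}" for x y
      using indep[of u x y] u that unfolding G_def link_edges_def by auto
    show "card T = 3 * m" "card W + m \<le> s" "s > 0"
      by fact+
    have N: "card (link_vertices V u) = n - 1"
      using \<open>u \<in> V\<close> V unfolding link_vertices_def by simp
    then show "card (link_vertices V u) \<ge> 99 * s"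
      using assms(2,3) by linarith
    have "card {(v, y). v \<in> T \<and> y \<in> R - {u} \<and> {v, y} \<in> G} \<le> c u"
      unfolding c_def
    proof (rule card_mono)
      show "finite {(v, y). v \<in> T \<and> y \<in> R \<and> {u, v, y} \<in> E}"
        by (rule finite_subset[of _ "T \<times> R"]) (use fin in auto)
    qed (auto simp: G_def link_edges_def insert_commute)
    then show "card {(v, y). v \<in> T \<and> y \<in> R - {u} \<and> {v, y} \<in> G} \<le> 19 * m * s"
      using u by linarith
    define q where "q = sqrt ((real s - 1)\<^sup>2 + 4 * real s * (real n - real s - 1))"
    have pos: "4 * real s * (real n - real s - 1) > 0"
      using assms(2,3) by (intro mult_pos_pos) linarith+
    then have q: "q\<^sup>2 = (real s - 1)\<^sup>2 + 4 * real s * (real n - real s - 1)" "q > 0"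
      unfolding q_def by (auto intro: add_nonneg_pos)
    have lq: "l = (real s - 1 + q) / 2"
      unfolding l_def q_def by simp
    show "l > 0"
      using q assms(2) unfolding lq by simp
    \<comment> \<open>The link has \<open>n - 1\<close> vertices, which accounts for the term
      \<open>real n - real s - 1\<close> under the root.\<close>
    show "l\<^sup>2 = (real s - 1) * l + real s * (real (card (link_vertices V u)) - real s)"
      using q(1) assms(1) unfolding N lq
      by (simp add: field_simps power2_eq_square of_nat_diff)
  qed
  then show False
    using assms(5) \<open>u \<in> V\<close> unfolding V_def G_def l_def by fastforce
qed

end
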